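(* If an abelian group $G$ is relatively co-Hopfian, then $G$ is Bassian-finite.
   Context: All groups are abelian, written additively. A group $G$ is Bassian-finite if there is no monomorphism from $G$ to any proper direct summand of $G$ (a direct summand different from $G$). A group $G$ is relatively co-Hopfian if for every monomorphism $\phi:G\to G$, the subgroup $\phi(G)$ is essential in $G$, i.e. $\phi(G)\cap B\neq\{0\}$ for every non-zero subgroup $B\leq G$. *)

theory Defs
  imports "HOL-Algebra.Algebra"
begin

text \<open>
  Groups are multiplicative in the library, so the neutral element is written \<open>\<one>\<close>, the trivial
  subgroup \<open>{\<one>}\<close> and the sum of subgroups \<open>H <#> K\<close>. A subgroup \<open>H\<close> of \<open>G\<close>, regarded as a group
  in its own right, is \<open>G\<lparr>carrier := H\<rparr>\<close>. The notions below are meant for abelian \<open>G\<close>.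
\<close>

definition direct_summand :: "'a set \<Rightarrow> ('a, 'b) monoid_scheme \<Rightarrow> bool" where
  "direct_summand H G \<longleftrightarrow>
     subgroup H G \<and>
     (\<exists>K. subgroup K G \<and> H \<inter> K = {\<one>\<^bsub>G\<^esub>} \<and> H <#>\<^bsub>G\<^esub> K = carrier G)"

definition bassian_finite :: "('a, 'b) monoid_scheme \<Rightarrow> bool" where
  "bassian_finite G \<longleftrightarrow>
     \<not> (\<exists>H \<phi>. direct_summand H G \<and> H \<noteq> carrier G \<and> \<phi> \<in> mon G (G\<lparr>carrier := H\<rparr>))"

definition essential_subgroup :: "'a set \<Rightarrow> ('a, 'b) monoid_scheme \<Rightarrow> bool" where
  "essential_subgroup E G \<longleftrightarrow>
     subgroup E G \<and> (\<forall>B. subgroup B G \<and> B \<noteq> {\<one>\<^bsub>G\<^esub>} \<longrightarrow> E \<inter> B \<noteq> {\<one>\<^bsub>G\<^esub>})"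

definition relatively_co_Hopfian :: "('a, 'b) monoid_scheme \<Rightarrow> bool" where
  "relatively_co_Hopfian G \<longleftrightarrow> (\<forall>\<phi> \<in> mon G G. essential_subgroup (\<phi> ` carrier G) G)"

end

theory Submission
  imports Defs
begin

text \<open>A monomorphism from \<open>G\<close> into a summand \<open>H\<close> is also an
  injective endomorphism of \<open>G\<close>, so its image is essential. That image lies in
  \<open>H\<close> and hence meets a complement \<open>K\<close> of \<open>H\<close> trivially;
  essentiality then forces \<open>K\<close> to be trivial, so \<open>H\<close> is all of
  \<open>G\<close>.\<close>

theorem corollary1p2:
  fixes G :: "('a, 'b) monoid_scheme"
  assumes "comm_group G"
    and "relatively_co_Hopfian G"
  shows "bassian_finite G"
  unfolding bassian_finite_def
proof (intro notI, elim exE conjE)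
  fix H \<phi>
  assume H: "direct_summand H G" "H \<noteq> carrier G" and \<phi>: "\<phi> \<in> mon G (G\<lparr>carrier := H\<rparr>)"
  interpret comm_group G by (fact assms(1))
  obtain K where K: "subgroup H G" "subgroup K G" "H \<inter> K = {\<one>\<^bsub>G\<^esub>}" "H <#>\<^bsub>G\<^esub> K = carrier G"
    using H(1) unfolding direct_summand_def by blast
  \<comment> \<open>Enlarging the codomain from \<open>H\<close> to \<open>G\<close> keeps the
    operation and injectivity.\<close>
  have "\<phi> \<in> mon G G"
    using \<phi> subgroup.subset[OF K(1)] by (auto simp: mon_def hom_def Pi_iff)
  then have ess: "essential_subgroup (\<phi> ` carrier G) G"
    using assms(2) by (simp add: relatively_co_Hopfian_def)
  have "\<phi> ` carrier G \<subseteq> H"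
    using \<phi> by (auto simp: mon_def hom_def)
  moreover have "\<one>\<^bsub>G\<^esub> \<in> \<phi> ` carrier G"
    using ess by (simp add: essential_subgroup_def subgroup.one_closed)
  ultimately have "\<phi> ` carrier G \<inter> K = {\<one>\<^bsub>G\<^esub>}"
    using K(3) by blast
  \<comment> \<open>Essentiality, used contrapositively with \<open>B\<close> taken to be
    \<open>K\<close>.\<close>
  then have "K = {\<one>\<^bsub>G\<^esub>}"
    using ess K(2) by (auto simp: essential_subgroup_def)
  then have "H <#>\<^bsub>G\<^esub> K = H"
    using subgroup.subset[OF K(1)] by (force simp: set_mult_def)
  with K(4) H(2) show False by simp
qed

end
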